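(* Let $\Delta$ be a simplicial complex with groundset $[n]$ and let $f_\Delta(t)=f_0+f_1t+\cdots+f_dt^d$ be its $f$-polynomial. Then the $h$-polynomial of $\Delta'$ is equal to $$h_{\Delta'}(t)=\sum_{i=0}^d f_iA_i(t)=\mathcal{A}(f_\Delta).$$
   Context: For $n\ge 0$, the $n$-th Eulerian polynomial is $A_n(t)=\sum_{k=0}^n A_{nk}t^k$, where $A_{nk}$ is the number of permutations $\sigma$ of $\{1,\dots,n\}$ such that $\sigma(i)\ge i$ for exactly $k$ indices $i$ (so $A_0(t)=1$). The map $\mathcal{A}:\mathbb{R}[t]\to\mathbb{R}[t]$ is the $\mathbb{R}$-linear operator determined by $\mathcal{A}(t^n)=A_n(t)$ for all $n\ge 0$. A simplicial complex on the groundset $[n]=\{1,\dots,n\}$ (or any finite groundset) is a non-empty set $\Delta$ of subsets of the groundset that is closed under taking subsets; its elements are called faces. The (combinatorial) dimension of a face $\sigma$ is $\dim\sigma=|\sigma|$ (one more than the usual topological dimension), and the dimension of $\Delta$ is the maximal dimension of its faces. If $\Delta$ is $d$-dimensional and $f_i(\Delta)$ denotes the number of faces of dimension $i$, its $f$-polynomial is $f_\Delta(t)=\sum_{\sigma\in\Delta}t^{\dim\sigma}=\sum_{i=0}^df_i(\Delta)t^i$ and its $h$-polynomial is $h_\Delta(t)=(1-t)^df_\Delta\left(\frac{t}{1-t}\right)$. Given a simplicial complex $\Delta$ on $[n]$, the simplicial complex $\Delta'$ has groundset $(2^{[n]}\setminus\{\emptyset\})\sqcup[n']$, where $2^{[n]}\setminus\{\emptyset\}$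 is the set of all non-empty subsets of $[n]$ and $[n']=\{1',2',\ldots,n'\}$ is a copy of $[n]$. The faces of $\Delta'$ are all sets of the form $$\{F_1\subsetneq F_2\subsetneq\cdots\subsetneq F_k\}\sqcup\{i':i\in S\},$$ where $0\le k\le n$, $F_1\subsetneq F_2\subsetneq\cdots\subsetneq F_k$ is a chain of non-empty elements of $\Delta$, and $S\subseteq[n]$ satisfies $S\cap F_k=\emptyset$ (no condition on $S$ when $k=0$). The complex $\Delta'$ is $n$-dimensional. *)

theory Defs
  imports
    "HOL-Combinatorics.Permutations"
    "HOL-Computational_Algebra.Computational_Algebra"
begin

section \<open>Eulerian polynomials\<close>

text \<open>These are the Eulerian numbers counting weak excedances, so that
  \<open>A\<^sub>1(t) = t\<close> and \<open>A\<^sub>2(t) = t + t\<^sup>2\<close>.\<close>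

definition eulerian_number :: "nat \<Rightarrow> nat \<Rightarrow> nat" where
  "eulerian_number n k =
     card {\<sigma>. \<sigma> permutes {1..n} \<and> card {i \<in> {1..n}. \<sigma> i \<ge> i} = k}"

definition eulerian_poly :: "nat \<Rightarrow> real poly" where
  "eulerian_poly n = (\<Sum>k\<le>n. monom (real (eulerian_number n k)) k)"

definition eulerian_op :: "real poly \<Rightarrow> real poly" where
  "eulerian_op p = (\<Sum>i\<le>degree p. smult (coeff p i) (eulerian_poly i))"

lemma eulerian_op_eq:
  assumes "degree p \<le> m"
  shows "eulerian_op p = (\<Sum>i\<le>m. smult (coeff p i) (eulerian_poly i))"
  unfolding eulerian_op_def using assms
  by (intro sum.mono_neutral_left) (auto simp: coeff_eq_0)

text \<open>\<open>eulerian_op\<close> is the unique linear operator sending \<open>t\<^sup>n\<close> to \<open>A\<^sub>n(t)\<close>.\<close>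

lemma eulerian_op_add: "eulerian_op (p + q) = eulerian_op p + eulerian_op q"
proof -
  define m where "m = max (degree p) (degree q)"
  have "degree (p + q) \<le> m" "degree p \<le> m" "degree q \<le> m"
    unfolding m_def using degree_add_le_max by auto
  then show ?thesis
    by (simp add: eulerian_op_eq smult_add_left sum.distrib)
qed

lemma eulerian_op_smult: "eulerian_op (smult c p) = smult c (eulerian_op p)"
proof -
  have sum: "smult c (\<Sum>i\<in>I. g i) = (\<Sum>i\<in>I. smult c (g i))"
    for g :: "nat \<Rightarrow> real poly" and I
    by (induction I rule: infinite_finite_induct) (simp_all add: smult_add_right)
  show ?thesis
    using eulerian_op_eq[OF degree_smult_le, of c p]
    by (simp add: eulerian_op_def sum)
qed

lemma eulerian_op_monom: "eulerian_op (monom 1 n) = eulerian_poly n"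
proof -
  have "eulerian_op (monom 1 n) =
      (\<Sum>i\<le>n. smult (coeff (monom 1 n) i) (eulerian_poly i))"
    by (rule eulerian_op_eq) (simp add: degree_monom_le)
  also have "\<dots> = (\<Sum>i\<le>n. if i = n then eulerian_poly i else 0)"
    by (intro sum.cong) auto
  finally show ?thesis by simp
qed

lemma eulerian_op_unique:
  assumes add: "\<And>p q. L (p + q) = L p + L q"
    and smult: "\<And>c p. L (smult c p) = smult c (L p)"
    and monom: "\<And>n. L (monom 1 n) = eulerian_poly n"
  shows "L = eulerian_op"
proof
  fix p :: "real poly"
  have zero: "L 0 = 0" using smult[of 0 0] by simp
  have sum: "L (\<Sum>i\<in>I. g i) = (\<Sum>i\<in>I. L (g i))" if "finite I" for g and I :: "nat set"
    using that by induction (simp_all add: zero add)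
  have "L p = L (\<Sum>i\<le>degree p. smult (coeff p i) (monom 1 i))"
    by (simp add: smult_monom poly_as_sum_of_monoms)
  also have "\<dots> = eulerian_op p"
    by (simp add: sum smult monom eulerian_op_def)
  finally show "L p = eulerian_op p" .
qed


section \<open>Simplicial complexes, \<open>f\<close>- and \<open>h\<close>-polynomials\<close>

text \<open>Elements of the groundset need not be vertices of the complex.\<close>

definition simplicial_complex_on :: "'a set \<Rightarrow> 'a set set \<Rightarrow> bool" where
  "simplicial_complex_on V \<Delta> \<longleftrightarrow>
     finite V \<and> \<Delta> \<noteq> {} \<and> \<Delta> \<subseteq> Pow V \<and> (\<forall>\<sigma>\<in>\<Delta>. \<forall>\<tau>. \<tau> \<subseteq> \<sigma> \<longrightarrow> \<tau> \<in> \<Delta>)"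

text \<open>The dimension of a face is its cardinality, one more than its topological dimension.\<close>

definition complex_dim :: "'a set set \<Rightarrow> nat" where
  "complex_dim \<Delta> = Max (card ` \<Delta>)"

definition face_count :: "'a set set \<Rightarrow> nat \<Rightarrow> nat" where
  "face_count \<Delta> i = card {\<sigma> \<in> \<Delta>. card \<sigma> = i}"

definition f_poly :: "'a set set \<Rightarrow> real poly" where
  "f_poly \<Delta> = (\<Sum>\<sigma>\<in>\<Delta>. monom 1 (card \<sigma>))"

text \<open>The identity \<open>h(t) = (1 - t)\<^sup>d f(t / (1 - t))\<close> is read in the field of
  rational functions, with \<open>t = to_fract [:0, 1:]\<close> and the real coefficients of \<open>f\<close>
  embedded as constants. The lemma \<open>h_poly_eq\<close> below shows that the description is proper.\<close>

definition h_poly :: "'a set set \<Rightarrow> real poly" where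
  "h_poly \<Delta> = (THE h. let t = to_fract [:0, 1:] in
     to_fract h = (1 - t) ^ complex_dim \<Delta> *
       poly (map_poly (\<lambda>c. to_fract [:c:]) (f_poly \<Delta>)) (t / (1 - t)))"

lemma f_poly_eq:
  assumes "finite \<Delta>"
  shows "f_poly \<Delta> = (\<Sum>i\<le>complex_dim \<Delta>. monom (real (face_count \<Delta> i)) i)"
proof -
  have "(\<Sum>i\<le>complex_dim \<Delta>. monom (real (face_count \<Delta> i)) i)
      = (\<Sum>i\<le>complex_dim \<Delta>. \<Sum>\<sigma> | \<sigma> \<in> \<Delta> \<and> card \<sigma> = i. monom 1 (card \<sigma>))"
    by (simp add: face_count_def of_nat_monom [symmetric] monom_altdef of_nat_poly)
  also have "\<dots> = f_poly \<Delta>"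
    unfolding f_poly_def complex_dim_def
    by (rule sum.group) (use assms in auto)
  finally show ?thesis ..
qed

lemma h_poly_eq:
  assumes "finite \<Delta>"
  shows "h_poly \<Delta> = (\<Sum>\<sigma>\<in>\<Delta>. monom 1 (card \<sigma>) * [:1, -1:] ^ (complex_dim \<Delta> - card \<sigma>))"
    (is "_ = ?h")
proof -
  define t :: "real poly fract" where "t = to_fract [:0, 1:]"
  have t1: "1 - t = to_fract [:1, -1:]"
    by (simp add: t_def flip: to_fract_1 to_fract_diff) (simp add: one_pCons)
  have nz: "1 - t \<noteq> 0"
    by (simp add: t1)
  have mul: "to_fract (p ^ k) = to_fract p ^ k" for p :: "real poly" and k
    by (induction k) simp_all
  have mp: "map_poly (\<lambda>c. to_fract [:c:]) (f_poly \<Delta>) = (\<Sum>\<sigma>\<in>\<Delta>. monom 1 (card \<sigma>))"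
  proof (rule poly_eqI)
    fix k
    have s: "to_fract [:\<Sum>x\<in>A. g x:] = (\<Sum>x\<in>A. to_fract [:g x:])"
      for A :: "'a set set" and g :: "'a set \<Rightarrow> real"
    proof (induction A rule: infinite_finite_induct)
      case (insert x F)
      have "[:\<Sum>x\<in>insert x F. g x:] = [:g x:] + [:\<Sum>x\<in>F. g x:]"
        using insert by simp
      then show ?case
        using insert by (simp del: add_pCons)
    qed simp_all
    show "coeff (map_poly (\<lambda>c. to_fract [:c:]) (f_poly \<Delta>)) k
        = coeff (\<Sum>\<sigma>\<in>\<Delta>. monom 1 (card \<sigma>)) k"
      by (simp add: coeff_map_poly f_poly_def coeff_sum s)
         (intro sum.cong, auto simp flip: one_pCons)
  qed
  have eq: "to_fract ?h = (1 - t) ^ complex_dim \<Delta> *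
      poly (map_poly (\<lambda>c. to_fract [:c:]) (f_poly \<Delta>)) (t / (1 - t))"
  proof -
    have "to_fract ?h = (\<Sum>\<sigma>\<in>\<Delta>. t ^ card \<sigma> * (1 - t) ^ (complex_dim \<Delta> - card \<sigma>))"
      unfolding t1 by (simp add: t_def mul monom_altdef)
    also have "\<dots> = (\<Sum>\<sigma>\<in>\<Delta>. (1 - t) ^ complex_dim \<Delta> * (t / (1 - t)) ^ card \<sigma>)"
    proof (rule sum.cong)
      fix \<sigma> assume "\<sigma> \<in> \<Delta>"
      then have "card \<sigma> \<le> complex_dim \<Delta>"
        using assms by (simp add: complex_dim_def)
      then show "t ^ card \<sigma> * (1 - t) ^ (complex_dim \<Delta> - card \<sigma>)
          = (1 - t) ^ complex_dim \<Delta> * (t / (1 - t)) ^ card \<sigma>"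
        using nz by (simp add: power_diff power_divide)
    qed simp
    finally show ?thesis
      by (simp add: mp poly_sum poly_monom sum_distrib_left)
  qed
  show ?thesis
    unfolding h_poly_def Let_def t_def [symmetric]
    by (rule the_equality, rule eq, rule iffD1 [OF to_fract_eq_iff]) (simp only: eq)
qed


section \<open>The complex \<open>\<Delta>'\<close>\<close>

text \<open>Non-empty subsets of \<open>[n]\<close> are tagged by \<open>Inl\<close> and the primed copies \<open>i'\<close> by \<open>Inr\<close>.
  The list \<open>Fs\<close> is the chain \<open>F\<^sub>1 \<subset> \<dots> \<subset> F\<^sub>k\<close>; since its members are non-empty subsets
  of \<open>[n]\<close>, the bound \<open>k \<le> n\<close> is automatic.\<close>

definition prime_groundset :: "nat \<Rightarrow> (nat set + nat) set" where
  "prime_groundset n = (Pow {1..n} - {{}}) <+> {1..n}"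

definition prime_complex :: "nat \<Rightarrow> nat set set \<Rightarrow> (nat set + nat) set set" where
  "prime_complex n \<Delta> =
     {set Fs <+> S | Fs S.
        sorted_wrt (\<subset>) Fs \<and> set Fs \<subseteq> \<Delta> - {{}} \<and>
        S \<subseteq> {1..n} \<and> (Fs \<noteq> [] \<longrightarrow> S \<inter> last Fs = {})}"

lemma sorted_wrt_psubset_last:
  assumes "sorted_wrt (\<subset>) Fs" "F \<in> set Fs"
  shows "F \<subseteq> last Fs"
  using assms by (induction Fs) (auto split: if_splits)

lemma simplicial_complex_on_prime:
  assumes "simplicial_complex_on {1..n} \<Delta>"
  shows "simplicial_complex_on (prime_groundset n) (prime_complex n \<Delta>)"
  unfolding simplicial_complex_on_def
proof (intro conjI ballI allI impI)
  show "finite (prime_groundset n)"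
    by (simp add: prime_groundset_def)
  have "set [] <+> {} \<in> prime_complex n \<Delta>"
    unfolding prime_complex_def by fastforce
  then show "prime_complex n \<Delta> \<noteq> {}"
    by blast
  show "prime_complex n \<Delta> \<subseteq> Pow (prime_groundset n)"
    using assms unfolding prime_complex_def prime_groundset_def simplicial_complex_on_def
    by blast
next
  fix \<sigma> \<tau> assume "\<sigma> \<in> prime_complex n \<Delta>" "\<tau> \<subseteq> \<sigma>"
  then obtain Fs S where \<sigma>: "\<sigma> = set Fs <+> S"
    and Fs: "sorted_wrt (\<subset>) Fs" "set Fs \<subseteq> \<Delta> - {{}}"
    and S: "S \<subseteq> {1..n}" "Fs \<noteq> [] \<Longrightarrow> S \<inter> last Fs = {}"
    unfolding prime_complex_def by blast
  define Gs where "Gs = filter (\<lambda>F. Inl F \<in> \<tau>) Fs"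
  define T where "T = {i. Inr i \<in> \<tau>}"
  have "\<tau> = set Gs <+> T"
    using \<open>\<tau> \<subseteq> \<sigma>\<close> unfolding \<sigma> Gs_def T_def by (auto simp: Plus_def)
  moreover have "sorted_wrt (\<subset>) Gs"
    unfolding Gs_def using Fs(1) by (rule sorted_wrt_filter)
  moreover have "set Gs \<subseteq> \<Delta> - {{}}"
    using Fs(2) by (auto simp: Gs_def)
  moreover have TS: "T \<subseteq> S"
    using \<open>\<tau> \<subseteq> \<sigma>\<close> by (auto simp: \<sigma> T_def)
  moreover have "T \<inter> last Gs = {}" if "Gs \<noteq> []"
  proof -
    have "last Gs \<in> set Gs"
      using that by simp
    then have mem: "last Gs \<in> set Fs"
      by (simp add: Gs_def)
    then have "last Gs \<subseteq> last Fs"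
      using Fs(1) sorted_wrt_psubset_last by blast
    moreover have "Fs \<noteq> []"
      using mem by auto
    ultimately show ?thesis
      using S(2) TS by blast
  qed
  ultimately show "\<tau> \<in> prime_complex n \<Delta>"
    using S(1) unfolding prime_complex_def by blast
qed

end

theory Submission
  imports Defs
begin

text \<open>
  A face of the complex \<open>\<Delta>'\<close> is a chain \<open>C\<close> of non-empty faces of \<open>\<Delta>\<close> together with a set of
  primed points avoiding the largest member of \<open>C\<close>. This largest member is \<open>F = \<Union>C\<close>, which is also
  correct for the empty chain, where no point is forbidden. Sort the faces of \<open>\<Delta>'\<close> by \<open>F\<close>. The
  primed points may be chosen freely outside \<open>F\<close>, so that they contribute
  \<open>(t + (1 - t))\<^sup>n\<^sup>-\<^sup>|\<^sup>F\<^sup>| = 1\<close> to the \<open>h\<close>-polynomial (\<open>h_poly_prime_complex\<close>):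
  \<open>h(\<Delta>') = (\<Sum>F\<in>\<Delta>. c(F))\<close>, where \<open>c(F)\<close> sums \<open>t ^ |C| * (1 - t) ^ (|F| - |C|)\<close> over the chains
  \<open>C\<close> of non-empty sets with union \<open>F\<close>. It remains to see that \<open>c(F) = A\<^sub>m(t)\<close> for \<open>m = |F|\<close>.

  Both sides satisfy the recurrence
  \<open>(1 - t) * x(F) = t * (\<Sum>G\<subset>F. (1 - t) ^ (|F| - |G|) * x(G))\<close> for \<open>F \<noteq> {}\<close>.
  For chains it expresses the removal of the top member \<open>F\<close> (\<open>chain_gf_rec\<close>). For the Eulerian
  polynomials (\<open>weak_exc_gf_rec\<close>) it combines two relations between \<open>A\<^sub>m\<close>, which counts weak
  excedances \<open>\<sigma>(i) \<ge> i\<close>, and the polynomial \<open>E\<^sub>m\<close> that counts strict excedances \<open>\<sigma>(i) > i\<close>: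

  \<^item> \<open>A\<^sub>m = t * E\<^sub>m\<close> for \<open>m > 0\<close>, because a cyclic shift of the positions trades strict excedances for
    weak ones (\<open>weak_exc_gf_eq_strict_exc_gf\<close>).
  \<^item> \<open>E\<^sub>m = (\<Sum>G\<subseteq>[m]. (1 - t) ^ (m - |G|) * A\<^bsub>|G|\<^esub>)\<close>, because the weight \<open>1\<close> of a fixed point in \<open>E\<^sub>m\<close>
    can be split as \<open>t + (1 - t)\<close>; once the fixed points of weight \<open>1 - t\<close> are chosen, the
    remaining points carry an arbitrary permutation, weighted by its weak excedances
    (\<open>strict_exc_gf_eq_sum_weak_exc_gf\<close>).

  Substituting the second relation into the first and moving the summand \<open>G = [m]\<close>, which is
  \<open>t * A\<^sub>m\<close>, to the left-hand side yields the recurrence.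
\<close>

section \<open>Excedances of permutations\<close>

definition weak_exc_gf :: "'a::comm_ring_1 \<Rightarrow> nat set \<Rightarrow> 'a" where
  "weak_exc_gf t F = (\<Sum>\<sigma> | \<sigma> permutes F. t ^ card {i \<in> F. i \<le> \<sigma> i})"

definition strict_exc_gf :: "'a::comm_ring_1 \<Rightarrow> nat set \<Rightarrow> 'a" where
  "strict_exc_gf t F = (\<Sum>\<sigma> | \<sigma> permutes F. t ^ card {i \<in> F. i < \<sigma> i})"

lemma eulerian_poly_eq_weak_exc_gf: "eulerian_poly n = weak_exc_gf [:0, 1:] {1..n}"
proof -
  let ?w = "\<lambda>\<sigma>. card {i \<in> {1..n}. i \<le> \<sigma> i}"
  have "weak_exc_gf [:0, 1:] {1..n} = (\<Sum>\<sigma> | \<sigma> permutes {1..n}. monom (1 :: real) (?w \<sigma>))"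
    by (simp add: weak_exc_gf_def monom_altdef)
  also have "\<dots> = (\<Sum>k\<le>n. \<Sum>\<sigma> | \<sigma> \<in> {\<sigma>. \<sigma> permutes {1..n}} \<and> ?w \<sigma> = k. monom 1 (?w \<sigma>))"
  proof (rule sum.group [symmetric])
    have "?w \<sigma> \<le> card {1..n}" for \<sigma> :: "nat \<Rightarrow> nat"
      by (rule card_mono) auto
    then show "?w ` {\<sigma>. \<sigma> permutes {1..n}} \<subseteq> {..n}"
      by auto
  qed (simp_all add: finite_permutations)
  also have "\<dots> = eulerian_poly n"
    by (simp add: eulerian_poly_def eulerian_number_def of_nat_monom [symmetric] monom_altdef of_nat_poly)
  finally show ?thesis ..
qed

lemma weak_exc_gf_empty [simp]: "weak_exc_gf t {} = 1"
  by (simp add: weak_exc_gf_def)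

text \<open>
  Conjugation by an order isomorphism preserves weak excedances. This is what allows the points
  left over after removing some fixed points to be renumbered.
\<close>

lemma weak_exc_gf_reindex:
  assumes bij: "bij_betw h A B" and mono: "strict_mono_on A h"
  shows "weak_exc_gf t A = weak_exc_gf t B"
proof -
  define g where "g = (\<lambda>\<sigma> x. if x \<in> B then h (\<sigma> (inv_into A h x)) else x)"
  have g: "bij_betw g {\<sigma>. \<sigma> permutes A} {\<sigma>. \<sigma> permutes B}"
    unfolding g_def by (rule bij_betw_permutations [OF bij])
  have "card {i \<in> B. i \<le> g \<sigma> i} = card {i \<in> A. i \<le> \<sigma> i}" if \<sigma>: "\<sigma> permutes A" for \<sigma>
  proof -
    have "g \<sigma> (h i) = h (\<sigma> i)" if "i \<in> A" for i
      using that bij by (simp add: g_def bij_betw_inv_into_left bij_betw_apply)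
    moreover have "h i \<le> h (\<sigma> i) \<longleftrightarrow> i \<le> \<sigma> i" if "i \<in> A" for i
      using that strict_mono_on_less_eq [OF mono] permutes_in_image [OF \<sigma>] by blast
    ultimately have "{i \<in> B. i \<le> g \<sigma> i} = h ` {i \<in> A. i \<le> \<sigma> i}"
      using bij_betw_imp_surj_on [OF bij] by force
    moreover have "inj_on h {i \<in> A. i \<le> \<sigma> i}"
      using bij by (auto simp: bij_betw_def inj_on_def)
    ultimately show ?thesis
      by (simp add: card_image)
  qed
  then show ?thesis
    unfolding weak_exc_gf_def sum.reindex_bij_betw [OF g, symmetric] by simp
qed

lemma weak_exc_gf_eq_card:
  assumes "finite F"
  shows "weak_exc_gf t F = weak_exc_gf t {1..card F}"
proof -
  obtain h where "bij_betw h {..<card F} F" "strict_mono_on {..<card F} h"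
    using ex_bij_betw_strict_mono_card [OF assms] .
  then have "weak_exc_gf t {..<card F} = weak_exc_gf t F"
    by (rule weak_exc_gf_reindex)
  moreover have "bij_betw Suc {..<card F} {1..card F}"
    by (simp add: bij_betw_def lessThan_atLeast0 atLeastLessThanSuc_atLeastAtMost)
  then have "weak_exc_gf t {..<card F} = weak_exc_gf t {1..card F}"
    by (rule weak_exc_gf_reindex) (simp add: strict_mono_on_def)
  ultimately show ?thesis
    by simp
qed

text \<open>
  Precompose \<open>\<sigma>\<close> with the cycle \<open>c\<close> that sends \<open>i\<close> to \<open>i - 1\<close> and \<open>1\<close> to \<open>m\<close>. The new value at \<open>i + 1\<close>
  is \<open>\<sigma>(i)\<close>, and \<open>\<sigma>(i) \<ge> i + 1\<close> means \<open>\<sigma>(i) > i\<close>. The position \<open>1\<close> is always a weak excedance of the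
  new permutation, while \<open>m\<close> is never a strict excedance of \<open>\<sigma>\<close>; hence exactly one is gained.
\<close>

lemma weak_exc_gf_eq_strict_exc_gf:
  assumes "m > 0"
  shows "weak_exc_gf t {1..m} = t * strict_exc_gf t {1..m}"
proof -
  define c where "c = (\<lambda>i. if i \<in> {1..m} then (if i = 1 then m else i - 1) else i)"
  have "bij_betw c {1..m} {1..m}"
    by (rule bij_betw_byWitness [where f' = "\<lambda>i. if i = m then 1 else Suc i"])
       (use assms in \<open>auto simp: c_def split: if_splits\<close>)
  then have c: "c permutes {1..m}"
    by (rule bij_imp_permutes) (auto simp: c_def)
  have "card {i \<in> {1..m}. i \<le> (\<sigma> \<circ> c) i} = Suc (card {i \<in> {1..m}. i < \<sigma> i})"
    if \<sigma>: "\<sigma> permutes {1..m}" for \<sigma>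
  proof -
    have range: "1 \<le> \<sigma> i \<and> \<sigma> i \<le> m" if "1 \<le> i" "i \<le> m" for i
      using that permutes_in_image [OF \<sigma>, of i] by simp
    have "{i \<in> {1..m}. i \<le> (\<sigma> \<circ> c) i} = insert 1 (Suc ` {i \<in> {1..m}. i < \<sigma> i})"
    proof (intro set_eqI)
      fix i
      show "i \<in> {i \<in> {1..m}. i \<le> (\<sigma> \<circ> c) i} \<longleftrightarrow> i \<in> insert 1 (Suc ` {i \<in> {1..m}. i < \<sigma> i})"
      proof (cases "i \<le> 1")
        case True
        then show ?thesis
          using assms range [of m] by (cases "i = 0") (auto simp: c_def)
      next
        case False
        then obtain j where "i = Suc j" "j \<ge> 1"
          by (cases i) auto
        then show ?thesis
          using range [of j] by (auto simp: c_def)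
      qed
    qed
    then have "card {i \<in> {1..m}. i \<le> (\<sigma> \<circ> c) i} = Suc (card (Suc ` {i \<in> {1..m}. i < \<sigma> i}))"
      by (simp only:) (rule card_insert_disjoint, auto)
    then show ?thesis
      by (simp add: card_image)
  qed
  then have "(\<Sum>\<sigma> | \<sigma> permutes {1..m}. t ^ card {i \<in> {1..m}. i \<le> (\<sigma> \<circ> c) i})
      = t * strict_exc_gf t {1..m}"
    unfolding strict_exc_gf_def sum_distrib_left
    by (intro sum.cong refl) (simp only: mem_Collect_eq power_Suc)
  then show ?thesis
    unfolding weak_exc_gf_def by (subst sum_permutations_compose_right [OF c])
qed

lemma sum_Pow_power_mult_power:
  fixes a b :: "'b::comm_semiring_1"
  assumes "finite A"
  shows "(\<Sum>X\<in>Pow A. a ^ card X * b ^ card (A - X)) = (a + b) ^ card A"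
  using prod_add [OF assms, of "\<lambda>_. a" "\<lambda>_. b"] by simp

text \<open>
  Here \<open>F - G\<close> is the set \<open>X\<close> of fixed points that are marked with \<open>1 - t\<close>. The permutations of \<open>F\<close>
  fixing \<open>X\<close> pointwise are those of \<open>F - X\<close>, and for a given \<open>\<sigma>\<close> the weak excedances outside \<open>X\<close> are
  the strict excedances and the unmarked fixed points. Summing over \<open>X\<close> therefore gives every fixed
  point the total weight \<open>(1 - t) + t = 1\<close>.
\<close>

lemma strict_exc_gf_eq_sum_weak_exc_gf:
  assumes "finite F"
  shows "strict_exc_gf t F = (\<Sum>G\<in>Pow F. (1 - t) ^ card (F - G) * weak_exc_gf t G)"
proof -
  have "(\<Sum>G\<in>Pow F. (1 - t) ^ card (F - G) * weak_exc_gf t G)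
      = (\<Sum>X\<in>Pow F. (1 - t) ^ card X * weak_exc_gf t (F - X))"
    by (rule sum.reindex_bij_witness [of _ "\<lambda>X. F - X" "\<lambda>X. F - X"]) (auto simp: double_diff)
  also have "\<dots> = (\<Sum>X\<in>Pow F. \<Sum>\<sigma> | \<sigma> \<in> {\<sigma>. \<sigma> permutes F} \<and> X \<subseteq> {i \<in> F. \<sigma> i = i}.
      (1 - t) ^ card X * t ^ card {i \<in> F - X. i \<le> \<sigma> i})"
  proof (rule sum.cong [OF refl])
    fix X assume "X \<in> Pow F"
    then have "{\<sigma>. \<sigma> permutes F - X} = {\<sigma> \<in> {\<sigma>. \<sigma> permutes F}. X \<subseteq> {i \<in> F. \<sigma> i = i}}"
      using permutes_subset [of _ "F - X" F] permutes_superset [of _ F "F - X"]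
        permutes_not_in [of _ "F - X"]
      by (auto simp: subset_iff)
    then show "(1 - t) ^ card X * weak_exc_gf t (F - X)
        = (\<Sum>\<sigma> | \<sigma> \<in> {\<sigma>. \<sigma> permutes F} \<and> X \<subseteq> {i \<in> F. \<sigma> i = i}.
            (1 - t) ^ card X * t ^ card {i \<in> F - X. i \<le> \<sigma> i})"
      by (simp add: weak_exc_gf_def sum_distrib_left)
  qed
  also have "\<dots> = (\<Sum>\<sigma> | \<sigma> permutes F. \<Sum>X | X \<in> Pow F \<and> X \<subseteq> {i \<in> F. \<sigma> i = i}.
      (1 - t) ^ card X * t ^ card {i \<in> F - X. i \<le> \<sigma> i})"
    using assms by (subst sum.swap_restrict) (simp_all add: finite_permutations)
  also have "\<dots> = strict_exc_gf t F"
    unfolding strict_exc_gf_def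
  proof (rule sum.cong [OF refl])
    fix \<sigma> :: "nat \<Rightarrow> nat"
    let ?fix = "{i \<in> F. \<sigma> i = i}" and ?exc = "{i \<in> F. i < \<sigma> i}"
    have "card {i \<in> F - X. i \<le> \<sigma> i} = card (?fix - X) + card ?exc" if "X \<subseteq> ?fix" for X
    proof -
      have "{i \<in> F - X. i \<le> \<sigma> i} = (?fix - X) \<union> ?exc"
        using that by auto
      then show ?thesis
        using assms by (simp add: card_Un_disjoint disjoint_iff)
    qed
    then have "(\<Sum>X | X \<in> Pow F \<and> X \<subseteq> ?fix. (1 - t) ^ card X * t ^ card {i \<in> F - X. i \<le> \<sigma> i})
        = (\<Sum>X\<in>Pow ?fix. (1 - t) ^ card X * t ^ card (?fix - X)) * t ^ card ?exc"
      unfolding sum_distrib_right by (intro sum.cong) (auto simp: power_add mult_ac)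
    also have "\<dots> = t ^ card ?exc"
      using assms by (simp add: sum_Pow_power_mult_power)
    finally show "(\<Sum>X | X \<in> Pow F \<and> X \<subseteq> ?fix. (1 - t) ^ card X * t ^ card {i \<in> F - X. i \<le> \<sigma> i})
        = t ^ card ?exc" .
  qed
  finally show ?thesis ..
qed

text \<open>
  Only cardinalities enter, so the sum over the subsets of \<open>[m]\<close> may be taken over the subsets of any
  \<open>m\<close>-element set \<open>F\<close> of any type. This is the form in which chains ending in \<open>F\<close> are counted.
\<close>

lemma weak_exc_gf_rec:
  assumes "finite F" "F \<noteq> {}"
  shows "(1 - t) * weak_exc_gf t {1..card F}
       = t * (\<Sum>G | G \<subset> F. (1 - t) ^ (card F - card G) * weak_exc_gf t {1..card G})"
proof -
  let ?m = "card F"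
  let ?f = "\<lambda>k. (1 - t) ^ (?m - k) * weak_exc_gf t {1..k}"
  have pos: "?m > 0"
    using assms by (simp add: card_gt_0_iff)
  obtain h where h: "bij_betw h F {1..?m}"
    using finite_same_card_bij [of F "{1..?m}"] assms by auto
  have summand: "(1 - t) ^ card ({1..?m} - G) * weak_exc_gf t G = ?f (card G)"
    if "G \<in> Pow {1..?m}" for G
  proof -
    have "finite G"
      using that finite_subset by blast
    then show ?thesis
      using that weak_exc_gf_eq_card [of G t] by (simp add: card_Diff_subset)
  qed
  have "weak_exc_gf t {1..?m} = t * (\<Sum>G\<in>Pow {1..?m}. ?f (card G))"
    unfolding weak_exc_gf_eq_strict_exc_gf [OF pos]
      strict_exc_gf_eq_sum_weak_exc_gf [OF finite_atLeastAtMost]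
    by (simp only: summand cong: sum.cong)
  also have "(\<Sum>G\<in>Pow {1..?m}. ?f (card G)) = (\<Sum>G\<in>Pow F. ?f (card (h ` G)))"
    by (rule sum.reindex_bij_betw [OF bij_betw_Pow [OF h], symmetric])
  also have "\<dots> = (\<Sum>G\<in>Pow F. ?f (card G))"
    using h by (intro sum.cong) (auto simp: card_image inj_on_subset bij_betw_def)
  also have "Pow F = insert F {G. G \<subset> F}"
    by auto
  also have "(\<Sum>G\<in>insert F {G. G \<subset> F}. ?f (card G)) = weak_exc_gf t {1..?m} + (\<Sum>G | G \<subset> F. ?f (card G))"
    using assms by (subst sum.insert) (auto intro: finite_subset [of _ "Pow F"])
  finally show ?thesis
    by (simp add: algebra_simps)
qed

section \<open>Chains of non-empty sets\<close>

text \<open>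
  The top of a non-empty finite chain is its union. Prescribing the union instead of the top lets
  the empty chain be the one chain that belongs to \<open>F = {}\<close>.
\<close>

definition chains_onto :: "'a set \<Rightarrow> 'a set set set" where
  "chains_onto F = {C. subset.chain (Pow F - {{}}) C \<and> \<Union>C = F}"

text \<open>
  A chain \<open>F\<^sub>1 \<subset> \<dots> \<subset> F\<^sub>k = F\<close> is the same as the ordered partition of \<open>F\<close> into the \<open>k\<close> blocks
  \<open>F\<^sub>i - F\<^sub>i\<^sub>-\<^sub>1\<close>, so this is the sum of \<open>k! S(m, k) t\<^sup>k (1 - t)\<^sup>m\<^sup>-\<^sup>k\<close> over \<open>k\<close>, with \<open>m = |F|\<close> and \<open>S(m, k)\<close>
  the Stirling numbers of the second kind (where \<open>F\<^sub>0 = {}\<close>).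
\<close>

definition chain_gf :: "'b::comm_ring_1 \<Rightarrow> 'a set \<Rightarrow> 'b" where
  "chain_gf t F = (\<Sum>C\<in>chains_onto F. t ^ card C * (1 - t) ^ (card F - card C))"

lemma chains_onto_empty [simp]: "chains_onto {} = {{}}"
  by (auto simp: chains_onto_def subset_chain_def)

lemma finite_chains_onto: "finite F \<Longrightarrow> finite (chains_onto F)"
  by (rule finite_subset [of _ "Pow (Pow F)"]) (auto simp: chains_onto_def)

lemma chains_onto_subset_Pow: "C \<in> chains_onto F \<Longrightarrow> C \<subseteq> Pow F"
  by (auto simp: chains_onto_def)

lemma top_in_chain:
  assumes "finite F" "F \<noteq> {}" "C \<in> chains_onto F"
  shows "F \<in> C"
proof -
  have "finite C"
    using chains_onto_subset_Pow [OF assms(3)] assms(1) finite_subset by blast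
  then show ?thesis
    using Union_in_chain [of C "Pow F - {{}}"] assms(2,3) by (auto simp: chains_onto_def)
qed

lemma remove_top_chain:
  assumes "finite F" "F \<noteq> {}" "C \<in> chains_onto F"
  shows "\<Union>(C - {F}) \<subset> F" "C - {F} \<in> chains_onto (\<Union>(C - {F}))"
proof -
  show onto: "C - {F} \<in> chains_onto (\<Union>(C - {F}))"
    using assms(3) by (auto simp: chains_onto_def subset_chain_def)
  have sub: "\<Union>(C - {F}) \<subseteq> F"
    using chains_onto_subset_Pow [OF assms(3)] by blast
  moreover have "\<Union>(C - {F}) \<noteq> F"
  proof
    assume "\<Union>(C - {F}) = F"
    then have "C - {F} \<in> chains_onto F"
      using onto by simp
    then have "F \<in> C - {F}"
      by (rule top_in_chain [OF assms(1,2)])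
    then show False
      by simp
  qed
  ultimately show "\<Union>(C - {F}) \<subset> F"
    by blast
qed

lemma add_top_chain:
  assumes "G \<subset> F" "C \<in> chains_onto G"
  shows "insert F C \<in> chains_onto F" "F \<notin> C"
  using assms by (auto simp: chains_onto_def subset_chain_def)

text \<open>
  Ensures that the subtraction in the exponent of \<open>1 - t\<close> in \<open>chain_gf\<close> is not truncated.
\<close>

lemma card_chain_le:
  assumes "finite F" "C \<in> chains_onto F"
  shows "card C \<le> card F"
  using assms
proof (induction F arbitrary: C rule: finite_psubset_induct)
  case (psubset F)
  show ?case
  proof (cases "F = {}")
    case True
    then show ?thesis
      using psubset.prems by simp
  next
    case False
    note top = psubset.hyps False psubset.prems
    have "card (C - {F}) \<le> card (\<Union>(C - {F}))"
      by (rule psubset.IH [OF remove_top_chain [OF top]])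
    also have "\<dots> < card F"
      by (rule psubset_card_mono [OF psubset.hyps remove_top_chain(1) [OF top]])
    finally show ?thesis
      using top_in_chain [OF top] by (simp add: card_Diff_singleton)
  qed
qed

text \<open>
  Removing the top member \<open>F\<close> of a chain leaves a chain onto the union \<open>G\<close> of the other members, and
  every proper subset \<open>G\<close> of \<open>F\<close> and every chain onto it arise in this way exactly once. The factor
  \<open>1 - t\<close> on the left-hand side makes the exponent of \<open>1 - t\<close> split additively.
\<close>

lemma chain_gf_rec:
  assumes "finite F" "F \<noteq> {}"
  shows "(1 - t) * chain_gf t F = t * (\<Sum>G | G \<subset> F. (1 - t) ^ (card F - card G) * chain_gf t G)"
proof -
  have fin: "finite {G. G \<subset> F}" "\<And>G. G \<subset> F \<Longrightarrow> finite G"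
    using assms(1) by (auto intro: finite_subset [of _ "Pow F"] finite_subset)
  have exponents: "Suc (card F - Suc (card C)) = (card F - card G) + (card G - card C)"
    if "G \<subset> F" "C \<in> chains_onto G" for G C
    using psubset_card_mono [OF assms(1) that(1)] card_chain_le [OF fin(2) that(2)] that(1)
    by simp
  have "(1 - t) * chain_gf t F = (\<Sum>C\<in>chains_onto F. t ^ card C * (1 - t) ^ Suc (card F - card C))"
    by (simp add: chain_gf_def sum_distrib_left mult_ac)
  also have "\<dots> = (\<Sum>(G, C)\<in>(SIGMA G:{G. G \<subset> F}. chains_onto G).
      t ^ Suc (card C) * (1 - t) ^ Suc (card F - Suc (card C)))"
  proof (rule sum.reindex_bij_witness
      [of _ "\<lambda>(G, C). insert F C" "\<lambda>C. (\<Union>(C - {F}), C - {F})"])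
    fix C assume C: "C \<in> chains_onto F"
    note top = top_in_chain [OF assms C]
    have "finite C"
      using chains_onto_subset_Pow [OF C] assms(1) finite_subset by blast
    then have "Suc (card (C - {F})) = card C"
      using top by (rule card_Suc_Diff1)
    then show "(case (\<Union>(C - {F}), C - {F}) of (G, C) \<Rightarrow>
        t ^ Suc (card C) * (1 - t) ^ Suc (card F - Suc (card C)))
        = t ^ card C * (1 - t) ^ Suc (card F - card C)"
      by (simp only: prod.case)
    show "(case (\<Union>(C - {F}), C - {F}) of (G, C) \<Rightarrow> insert F C) = C"
      using top by auto
    show "(\<Union>(C - {F}), C - {F}) \<in> (SIGMA G:{G. G \<subset> F}. chains_onto G)"
      using remove_top_chain [OF assms C] by simp
  next
    fix x assume "x \<in> (SIGMA G:{G. G \<subset> F}. chains_onto G)"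
    then obtain G C where x: "x = (G, C)" and G: "G \<subset> F" and C: "C \<in> chains_onto G"
      by auto
    note add = add_top_chain [OF G C]
    show "(case x of (G, C) \<Rightarrow> insert F C) \<in> chains_onto F"
      using add by (simp add: x)
    have "\<Union>C = G"
      using C by (simp add: chains_onto_def)
    then show "(\<Union>((case x of (G, C) \<Rightarrow> insert F C) - {F}), (case x of (G, C) \<Rightarrow> insert F C) - {F}) = x"
      using add by (simp add: x)
  qed
  also have "\<dots> = (\<Sum>G | G \<subset> F. \<Sum>C\<in>chains_onto G.
      t ^ Suc (card C) * (1 - t) ^ Suc (card F - Suc (card C)))"
    using fin by (simp add: sum.Sigma finite_chains_onto)
  also have "\<dots> = t * (\<Sum>G | G \<subset> F. (1 - t) ^ (card F - card G) * chain_gf t G)"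
    unfolding chain_gf_def sum_distrib_left
    by (intro sum.cong refl) (simp only: mem_Collect_eq exponents power_add power_Suc mult_ac)
  finally show ?thesis .
qed

text \<open>
  This is Frobenius' formula for the Eulerian polynomials. The common recurrence determines
  the values only up to the factor \<open>1 - t\<close>, which has to be cancelled.
\<close>

lemma chain_gf_eq_weak_exc_gf:
  fixes t :: "'b::idom"
  assumes "t \<noteq> 1" "finite F"
  shows "chain_gf t F = weak_exc_gf t {1..card F}"
  using assms(2)
proof (induction F rule: finite_psubset_induct)
  case (psubset F)
  show ?case
  proof (cases "F = {}")
    case True
    then show ?thesis
      by (simp add: chain_gf_def)
  next
    case False
    then have "(1 - t) * chain_gf t F = (1 - t) * weak_exc_gf t {1..card F}"
      unfolding chain_gf_rec [OF psubset.hyps False] weak_exc_gf_rec [OF psubset.hyps False]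
      by (intro arg_cong [where f = "(*) t"] sum.cong refl) (simp only: mem_Collect_eq psubset.IH)
    then show ?thesis
      using assms(1) by simp
  qed
qed

section \<open>Faces of the primed complex\<close>

lemma finite_simplicial_complex:
  assumes "simplicial_complex_on V \<Delta>"
  shows "finite \<Delta>" and "F \<in> \<Delta> \<Longrightarrow> finite F"
proof -
  have V: "finite V" "\<Delta> \<subseteq> Pow V"
    using assms by (auto simp: simplicial_complex_on_def)
  show "finite \<Delta>"
    by (rule finite_subset [OF V(2)]) (simp add: V(1))
  show "finite F" if "F \<in> \<Delta>"
    using V that by (blast intro: finite_subset)
qed

lemma ex_sorted_list_of_chain:
  assumes "finite C" "subset.chain A C"
  shows "\<exists>Fs. sorted_wrt (\<subset>) Fs \<and> set Fs = C"
  using assms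
proof (induction C rule: finite_psubset_induct)
  case (psubset C)
  show ?case
  proof (cases "C = {}")
    case True
    then show ?thesis
      by (intro exI [of _ "[]"]) simp
  next
    case False
    have top: "\<Union>C \<in> C"
      using Union_in_chain psubset.hyps False psubset.prems by blast
    then have "C - {\<Union>C} \<subset> C"
      by blast
    moreover have "subset.chain A (C - {\<Union>C})"
      using psubset.prems by (auto simp: subset_chain_def)
    ultimately obtain Fs where "sorted_wrt (\<subset>) Fs" "set Fs = C - {\<Union>C}"
      using psubset.IH by blast
    moreover from this have "\<forall>F\<in>set Fs. F \<subset> \<Union>C"
      by blast
    ultimately have "sorted_wrt (\<subset>) (Fs @ [\<Union>C]) \<and> set (Fs @ [\<Union>C]) = C"
      using top by (auto simp: sorted_wrt_append)
    then show ?thesis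
      by blast
  qed
qed

lemma subset_chain_set_sorted:
  "sorted_wrt (\<subset>) Fs \<Longrightarrow> set Fs \<subseteq> A \<Longrightarrow> subset.chain A (set Fs)"
  by (induction Fs) (auto simp: subset_chain_def)

lemma Union_set_sorted_eq_last:
  assumes "sorted_wrt (\<subset>) Fs" "Fs \<noteq> []"
  shows "\<Union>(set Fs) = last Fs"
  using assms sorted_wrt_psubset_last by (metis Union_least Union_upper last_in_set subset_antisym)

text \<open>
  Dropping the order of the list and naming the union \<open>F\<close> of the chain removes the case distinction
  on the empty chain, since \<open>F = {}\<close> imposes no condition on \<open>S\<close>. All members of a chain onto \<open>F\<close>
  lie in \<open>\<Delta>\<close> because \<open>\<Delta>\<close> is closed under subsets.
\<close>

lemma prime_complex_eq:
  assumes "simplicial_complex_on {1..n} \<Delta>"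
  shows "prime_complex n \<Delta> =
    {C <+> S | C S. \<exists>F\<in>\<Delta>. C \<in> chains_onto F \<and> S \<subseteq> {1..n} - F}" (is "_ = ?R")
proof (intro equalityI subsetI)
  fix \<sigma> assume "\<sigma> \<in> prime_complex n \<Delta>"
  then obtain Fs S where \<sigma>: "\<sigma> = set Fs <+> S" and Fs: "sorted_wrt (\<subset>) Fs" "set Fs \<subseteq> \<Delta> - {{}}"
    and S: "S \<subseteq> {1..n}" "Fs \<noteq> [] \<Longrightarrow> S \<inter> last Fs = {}"
    unfolding prime_complex_def by blast
  have empty: "{} \<in> \<Delta>"
    using assms by (auto simp: simplicial_complex_on_def)
  have "\<Union>(set Fs) \<in> \<Delta> \<and> S \<subseteq> {1..n} - \<Union>(set Fs)"
  proof (cases "Fs = []")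
    case True
    then show ?thesis
      using empty S(1) by simp
  next
    case False
    then have "last Fs \<in> \<Delta>"
      using Fs(2) last_in_set by blast
    then show ?thesis
      unfolding Union_set_sorted_eq_last [OF Fs(1) False] using S(1) S(2) [OF False] by blast
  qed
  moreover have "set Fs \<in> chains_onto (\<Union>(set Fs))"
    using Fs(2) by (auto simp: chains_onto_def intro!: subset_chain_set_sorted [OF Fs(1)])
  ultimately show "\<sigma> \<in> ?R"
    unfolding \<sigma> by blast
next
  fix \<sigma> assume "\<sigma> \<in> ?R"
  then obtain C S F where \<sigma>: "\<sigma> = C <+> S" and F: "F \<in> \<Delta>"
    and C: "C \<in> chains_onto F" and S: "S \<subseteq> {1..n} - F"
    by blast
  have "finite F" "C \<subseteq> \<Delta> - {{}}"
    using assms F C finite_subset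
    by (auto simp: simplicial_complex_on_def chains_onto_def subset_chain_def)
  then have "finite C"
    using chains_onto_subset_Pow [OF C] finite_subset by blast
  then obtain Fs where Fs: "sorted_wrt (\<subset>) Fs" "set Fs = C"
    using C ex_sorted_list_of_chain unfolding chains_onto_def by blast
  have "S \<inter> last Fs = {}" if "Fs \<noteq> []"
    using Union_set_sorted_eq_last [OF Fs(1) that] Fs(2) C S by (auto simp: chains_onto_def)
  then show "\<sigma> \<in> prime_complex n \<Delta>"
    unfolding prime_complex_def \<sigma> using Fs \<open>C \<subseteq> \<Delta> - {{}}\<close> S by blast
qed

lemma sum_prime_complex:
  assumes "simplicial_complex_on {1..n} \<Delta>"
  shows "sum g (prime_complex n \<Delta>) =
    (\<Sum>F\<in>\<Delta>. \<Sum>C\<in>chains_onto F. \<Sum>S\<in>Pow ({1..n} - F). g (C <+> S))"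
proof -
  let ?I = "SIGMA F:\<Delta>. chains_onto F \<times> Pow ({1..n} - F)"
  let ?face = "\<lambda>(F, C, S). C <+> S"
  have inj: "inj_on ?face ?I"
  proof (rule inj_onI)
    fix x y assume "x \<in> ?I" "y \<in> ?I" and face: "?face x = ?face y"
    then obtain F C S F' C' S' where x: "x = (F, C, S)" and y: "y = (F', C', S')"
      and C: "C \<in> chains_onto F" "C' \<in> chains_onto F'"
      by auto
    then have eq: "C <+> S = C' <+> S'"
      using face by simp
    have "C = {x. Inl x \<in> C <+> S}" "C' = {x. Inl x \<in> C' <+> S'}"
      "S = {x. Inr x \<in> C <+> S}" "S' = {x. Inr x \<in> C' <+> S'}"
      by auto
    then have "C = C' \<and> S = S'"
      using eq by simp
    then show "x = y"
      using C by (auto simp: x y chains_onto_def)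
  qed
  note fin = finite_simplicial_complex [OF assms]
  have "prime_complex n \<Delta> = ?face ` ?I"
    unfolding prime_complex_eq [OF assms] by (auto simp: image_iff)
  then have "sum g (prime_complex n \<Delta>) = (\<Sum>(F, C, S)\<in>?I. g (C <+> S))"
    by (simp only: sum.reindex [OF inj]) (simp add: case_prod_unfold)
  also have "\<dots> = (\<Sum>F\<in>\<Delta>. \<Sum>(C, S)\<in>chains_onto F \<times> Pow ({1..n} - F). g (C <+> S))"
    using fin by (subst sum.Sigma) (auto simp: finite_chains_onto)
  also have "\<dots> = (\<Sum>F\<in>\<Delta>. \<Sum>C\<in>chains_onto F. \<Sum>S\<in>Pow ({1..n} - F). g (C <+> S))"
    by (simp add: sum.cartesian_product)
  finally show ?thesis .
qed

lemma card_Plus_chain: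
  assumes "finite F" "C \<in> chains_onto F" "finite S"
  shows "card (C <+> S) = card C + card S"
  using assms chains_onto_subset_Pow finite_subset by (metis card_Plus finite_Pow_iff)

text \<open>
  The bound holds because a chain onto \<open>F\<close> has at most \<open>|F|\<close> members and at most \<open>n - |F|\<close> primed
  points are available. The face consisting of all primed points attains it.
\<close>

lemma complex_dim_prime_complex:
  assumes "simplicial_complex_on {1..n} \<Delta>"
  shows "complex_dim (prime_complex n \<Delta>) = n"
  unfolding complex_dim_def
proof (rule Max_eqI)
  have "finite (prime_complex n \<Delta>)"
    by (rule finite_simplicial_complex(1) [OF simplicial_complex_on_prime [OF assms]])
  then show "finite (card ` prime_complex n \<Delta>)"
    by simp
next
  fix k assume "k \<in> card ` prime_complex n \<Delta>"
  then obtain F C S where k: "k = card (C <+> S)" and F: "F \<in> \<Delta>"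
    and C: "C \<in> chains_onto F" and S: "S \<subseteq> {1..n} - F"
    unfolding prime_complex_eq [OF assms] by blast
  have sub: "F \<subseteq> {1..n}"
    using assms F by (auto simp: simplicial_complex_on_def)
  then have fin: "finite F" "finite S"
    using S finite_subset by (blast, blast)
  have "card S \<le> n - card F"
    using card_mono [OF _ S] sub fin by (simp add: card_Diff_subset)
  moreover have "card F \<le> n"
    using card_mono [OF _ sub] by simp
  ultimately show "k \<le> n"
    using card_chain_le [OF fin(1) C] by (simp add: k card_Plus_chain [OF fin(1) C fin(2)])
next
  have "{} \<in> \<Delta>"
    using assms by (auto simp: simplicial_complex_on_def)
  then have "\<exists>F\<in>\<Delta>. {} \<in> chains_onto F \<and> {1..n} \<subseteq> {1..n} - F"
    by (intro bexI [of _ "{}"]) simp_all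
  then have "{} <+> {1..n} \<in> prime_complex n \<Delta>"
    unfolding prime_complex_eq [OF assms] by blast
  then show "n \<in> card ` prime_complex n \<Delta>"
    by (rule rev_image_eqI) (simp add: card_Plus)
qed

text \<open>
  The exponent \<open>n - |C| - |S|\<close> of \<open>1 - t\<close> splits into \<open>|F| - |C|\<close>, which belongs to the chain, and
  the number of points outside both \<open>F\<close> and \<open>S\<close>. The latter turns the sum over \<open>S\<close> into a binomial
  expansion of \<open>t + (1 - t)\<close>.
\<close>

lemma h_poly_prime_complex:
  assumes "simplicial_complex_on {1..n} \<Delta>"
  shows "h_poly (prime_complex n \<Delta>) = (\<Sum>F\<in>\<Delta>. chain_gf [:0, 1:] F)"
proof -
  define t :: "real poly" where "t = [:0, 1:]"
  have t: "[:1, -1:] = 1 - t"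
    by (simp add: t_def one_pCons)
  have "finite (prime_complex n \<Delta>)"
    by (rule finite_simplicial_complex(1) [OF simplicial_complex_on_prime [OF assms]])
  then have "h_poly (prime_complex n \<Delta>)
      = (\<Sum>\<sigma>\<in>prime_complex n \<Delta>. t ^ card \<sigma> * (1 - t) ^ (n - card \<sigma>))"
    by (simp add: h_poly_eq complex_dim_prime_complex [OF assms] t monom_altdef flip: t_def)
  also have "\<dots> = (\<Sum>F\<in>\<Delta>. chain_gf t F)"
    unfolding sum_prime_complex [OF assms] chain_gf_def
  proof (intro sum.cong refl)
    fix F C assume F: "F \<in> \<Delta>" and C: "C \<in> chains_onto F"
    let ?R = "{1..n} - F"
    have sub: "F \<subseteq> {1..n}"
      using assms F by (auto simp: simplicial_complex_on_def)
    then have fin: "finite F"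
      using finite_subset by blast
    have "card F \<le> n"
      using card_mono [OF _ sub] by simp
    then have R: "n - card C = (card F - card C) + card ?R"
      using sub fin card_chain_le [OF fin C] by (simp add: card_Diff_subset)
    have "t ^ card (C <+> S) * (1 - t) ^ (n - card (C <+> S))
        = t ^ card C * (1 - t) ^ (card F - card C) * (t ^ card S * (1 - t) ^ card (?R - S))"
      if "S \<in> Pow ?R" for S
    proof -
      have S: "S \<subseteq> ?R" "finite S"
        using that finite_subset [of S ?R] by auto
      then have "card S \<le> card ?R" "card (?R - S) = card ?R - card S"
        by (auto intro: card_mono simp: card_Diff_subset)
      then have "n - (card C + card S) = (card F - card C) + card (?R - S)"
        using R by simp
      then show ?thesis
        by (simp add: card_Plus_chain [OF fin C S(2)] power_add mult_ac)
    qed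
    then have "(\<Sum>S\<in>Pow ?R. t ^ card (C <+> S) * (1 - t) ^ (n - card (C <+> S)))
        = t ^ card C * (1 - t) ^ (card F - card C) * (\<Sum>S\<in>Pow ?R. t ^ card S * (1 - t) ^ card (?R - S))"
      by (simp add: sum_distrib_left)
    also have "(\<Sum>S\<in>Pow ?R. t ^ card S * (1 - t) ^ card (?R - S)) = 1"
      by (simp add: sum_Pow_power_mult_power)
    finally show "(\<Sum>S\<in>Pow ?R. t ^ card (C <+> S) * (1 - t) ^ (n - card (C <+> S)))
        = t ^ card C * (1 - t) ^ (card F - card C)"
      by simp
  qed
  finally show ?thesis
    by (simp add: t_def)
qed

section \<open>The Eulerian transform of the face polynomial\<close>

lemma eulerian_op_sum: "eulerian_op (\<Sum>i\<in>I. g i) = (\<Sum>i\<in>I. eulerian_op (g i))"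
proof -
  have zero: "eulerian_op 0 = 0"
    using eulerian_op_smult [of 0 0] by simp
  show ?thesis
    by (induction I rule: infinite_finite_induct) (simp_all add: zero eulerian_op_add)
qed

lemma eulerian_op_monom_smult: "eulerian_op (monom c k) = smult c (eulerian_poly k)"
  using eulerian_op_smult [of c "monom 1 k"] by (simp add: smult_monom eulerian_op_monom)

theorem theorem5p1:
  fixes n :: nat and \<Delta> :: "nat set set"
  assumes "simplicial_complex_on {1..n} \<Delta>"
  shows "h_poly (prime_complex n \<Delta>) =
           (\<Sum>i\<le>complex_dim \<Delta>. smult (real (face_count \<Delta> i)) (eulerian_poly i)) \<and>
         (\<Sum>i\<le>complex_dim \<Delta>. smult (real (face_count \<Delta> i)) (eulerian_poly i)) =
           eulerian_op (f_poly \<Delta>)"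
proof -
  note fin = finite_simplicial_complex [OF assms]
  have graded: "(\<Sum>i\<le>complex_dim \<Delta>. smult (real (face_count \<Delta> i)) (eulerian_poly i))
      = eulerian_op (f_poly \<Delta>)"
    by (simp add: f_poly_eq [OF fin(1)] eulerian_op_sum eulerian_op_monom_smult)
  have "[:0, 1:] \<noteq> (1 :: real poly)"
    by (simp add: one_pCons)
  then have "h_poly (prime_complex n \<Delta>) = (\<Sum>F\<in>\<Delta>. eulerian_poly (card F))"
    using fin by (simp add: h_poly_prime_complex [OF assms] chain_gf_eq_weak_exc_gf
        eulerian_poly_eq_weak_exc_gf)
  also have "\<dots> = eulerian_op (f_poly \<Delta>)"
    by (simp add: f_poly_def eulerian_op_sum eulerian_op_monom)
  finally show ?thesis
    using graded by simp
qed

end
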